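(* Let $\mathcal{S}=\langle S,s_0,\tau,l\rangle$ be a $\Gamma$-labeled $\Upsilon$-transition system, let $n,m\ge 0$, and let $\varphi$ be a quantifier-free HyperLTL formula. (1) Consider the formula $\forall \pi_1 \ldots \forall \pi_n.\ \exists \pi_1' \ldots \exists \pi_m'.\ \varphi$, where the free trace variables of $\varphi$ are among $\pi_1,\dots,\pi_n,\pi_1',\dots,\pi_m'$. Suppose there is a strategy $\sigma\colon (\Upsilon^n)^*\to\Upsilon^m$ with the following property: for every infinite sequence $u=u_0u_1u_2\ldots\in(\Upsilon^n)^\omega$, writing $u_i=(u_i^1,\dots,u_i^n)$ and $v_i=\sigma(u_0\cdots u_{i-1})=(v_i^1,\dots,v_i^m)\in\Upsilon^m$ for all $i\ge 0$, and letting $\rho_j$ be the trace of $\mathcal{S}$ on the input word $u_0^ju_1^ju_2^j\ldots$ ($1\le j\le n$) and $\rho'_k$ the trace of $\mathcal{S}$ on the input word $v_0^kv_1^kv_2^k\ldots$ ($1\le k\le m$), the assignment $\Pi$ with $\Pi(\pi_j)=\rho_j$ and $\Pi(\pi'_k)=\rho'_k$ satisfies $\Pi,0\models\varphi$. Then $\mathcal{S}\models \forall \pi_1 \ldots \forall \pi_n.\ \exists \pi_1' \ldots \exists \pi_m'.\ \varphi$. (2) Consider the formula $\exists \pi_1 \ldots \exists \pi_m.\ \forall \pi_1' \ldots \forall \pi_n'.\ \varphi$, where the free trace variables of $\varphi$ are among $\pi_1,\dots,\pi_m,\pi_1',\dots,\pi_n'$. Suppose there is a strategy $\sigma\colon(\Upsilon^0)^*\to\Upsilon^m$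 (since $\Upsilon^0$ is a singleton, $\sigma$ amounts to an infinite sequence $w=w_0w_1\ldots\in(\Upsilon^m)^\omega$, $w_i$ being the value of $\sigma$ on the unique history of length $i$) with the following property: writing $w_i=(w_i^1,\dots,w_i^m)$ and letting $\rho_k$ be the trace of $\mathcal{S}$ on $w_0^kw_1^k\ldots$ ($1\le k\le m$), for all traces $\rho'_1,\dots,\rho'_n\in\mathit{traces}(\mathcal{S})$ the assignment $\Pi$ with $\Pi(\pi_k)=\rho_k$, $\Pi(\pi'_j)=\rho'_j$ satisfies $\Pi,0\models\varphi$. Then $\mathcal{S}\models \exists \pi_1 \ldots \exists \pi_m.\ \forall \pi_1' \ldots \forall \pi_n'.\ \varphi$.
   Context: Let $I$ and $O$ be disjoint finite sets of input and output propositions, $\Upsilon=2^I$, $\Gamma=2^O$, $\mathrm{AP}=I\cup O$, $\Sigma=2^{\mathrm{AP}}$. A $\Gamma$-labeled $\Upsilon$-transition system is $\mathcal{S}=\langle S,s_0,\tau,l\rangle$ with $S$ finite, $s_0\in S$, $\tau\colon S\times\Upsilon\to S$, $l\colon S\to\Gamma$. Extend $\tau$ to $\tau^*\colon\Upsilon^*\to S$ by $\tau^*(\epsilon)=s_0$ and $\tau^*(x\upsilon)=\tau(\tau^*(x),\upsilon)$. The trace of $\mathcal{S}$ on an input word $\upsilon_0\upsilon_1\ldots\in\Upsilon^\omega$ is $(\upsilon_0\cup\gamma_0)(\upsilon_1\cup\gamma_1)\ldots\in\Sigma^\omega$ where $\gamma_i=l(\tau^*(\upsilon_0\cdots\upsilon_{i-1}))$;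 $\mathit{traces}(\mathcal{S})$ is the set of all such traces. A strategy is any function $\sigma\colon(\Upsilon^n)^*\to\Upsilon^m$. HyperLTL formulas over trace variables are given by $\varphi::=\forall\pi.\varphi\mid\exists\pi.\varphi\mid\psi$, $\psi::=a_\pi\mid\neg\psi\mid\psi\vee\psi\mid \mathsf{X}\psi\mid\psi\,\mathsf{U}\,\psi$ ($a\in\mathrm{AP}$), with the usual derived operators ($\wedge,\rightarrow,\leftrightarrow$, $\mathsf{F}\psi=\mathit{true}\,\mathsf{U}\,\psi$, $\mathsf{G}\psi=\neg\mathsf{F}\neg\psi$, etc.). Semantics w.r.t. a trace set $Tr$, an assignment $\Pi$ of traces to trace variables, and a position $i$: $\Pi,i\models a_\pi$ iff $a\in\Pi(\pi)[i]$; Boolean connectives as usual; $\Pi,i\models\mathsf{X}\psi$ iff $\Pi,i+1\models\psi$; $\Pi,i\models\psi_1\mathsf{U}\psi_2$ iff there is $j\ge i$ with $\Pi,j\models\psi_2$ and $\Pi,k\models\psi_1$ for all $i\le k<j$; $\Pi,i\models_{Tr}\exists\pi.\varphi$ iff $\Pi[\pi\mapsto t],i\models_{Tr}\varphi$ for some $t\in Tr$; $\Pi,i\models_{Tr}\forall\pi.\varphi$ iff this holds for all $t\in Tr$. A quantifier-free formula does not depend on $Tr$. $\mathcal{S}\models\varphi$ iff $\emptyset,0\models_{\mathit{traces}(\mathcal{S})}\varphi$ for the empty assignment. *)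

theory Defs
  imports Main
begin

type_synonym 'a word = "nat \<Rightarrow> 'a set"

text \<open>
  A transition system is built over an input alphabet \<open>Pow Inp\<close> and an output alphabet \<open>Pow Out\<close>.
  The functions \<open>step\<close> and \<open>label\<close> are total in HOL; only their values on \<open>states\<close> and \<open>Pow Inp\<close>
  are constrained and relevant.
\<close>

record ('s, 'a) transys =
  states :: "'s set"
  init :: 's
  step :: "'s \<Rightarrow> 'a set \<Rightarrow> 's"
  label :: "'s \<Rightarrow> 'a set"

definition transition_system :: "'a set \<Rightarrow> 'a set \<Rightarrow> ('s, 'a) transys \<Rightarrow> bool" where
  "transition_system Inp Out \<S> \<longleftrightarrow>
     finite (states \<S>) \<and> init \<S> \<in> states \<S> \<and>
     (\<forall>s \<in> states \<S>. \<forall>\<upsilon> \<in> Pow Inp. step \<S> s \<upsilon> \<in> states \<S>) \<and>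
     (\<forall>s \<in> states \<S>. label \<S> s \<in> Pow Out)"

definition step_star :: "('s, 'a) transys \<Rightarrow> 'a set list \<Rightarrow> 's" where
  "step_star \<S> x = foldl (step \<S>) (init \<S>) x"

text \<open>The list \<open>prefix w i\<close> consists of the first \<open>i\<close> letters \<open>w 0, \<dots>, w (i - 1)\<close>.\<close>

definition prefix :: "(nat \<Rightarrow> 'b) \<Rightarrow> nat \<Rightarrow> 'b list" where
  "prefix w i = map w [0..<i]"

definition trace_on :: "('s, 'a) transys \<Rightarrow> 'a word \<Rightarrow> 'a word" where
  "trace_on \<S> w = (\<lambda>i. w i \<union> label \<S> (step_star \<S> (prefix w i)))"

definition traces :: "'a set \<Rightarrow> ('s, 'a) transys \<Rightarrow> 'a word set" where
  "traces Inp \<S> = {trace_on \<S> w | w. \<forall>i. w i \<in> Pow Inp}"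

datatype (props: 'a, tvars: 'v) qf =
    Atom 'a 'v
  | Neg "('a, 'v) qf"
  | Disj "('a, 'v) qf" "('a, 'v) qf"
  | Next "('a, 'v) qf"
  | Until "('a, 'v) qf" "('a, 'v) qf"

datatype ('a, 'v) hyperltl =
    Forall 'v "('a, 'v) hyperltl"
  | Exists 'v "('a, 'v) hyperltl"
  | QF "('a, 'v) qf"

text \<open>Trace assignments are partial; an atom over an unassigned trace variable is false.\<close>

type_synonym ('a, 'v) assignment = "'v \<rightharpoonup> 'a word"

primrec qf_sat :: "('a, 'v) assignment \<Rightarrow> nat \<Rightarrow> ('a, 'v) qf \<Rightarrow> bool" where
  "qf_sat \<Pi> i (Atom a \<pi>) \<longleftrightarrow> (\<exists>t. \<Pi> \<pi> = Some t \<and> a \<in> t i)"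
| "qf_sat \<Pi> i (Neg \<psi>) \<longleftrightarrow> \<not> qf_sat \<Pi> i \<psi>"
| "qf_sat \<Pi> i (Disj \<psi>\<^sub>1 \<psi>\<^sub>2) \<longleftrightarrow> qf_sat \<Pi> i \<psi>\<^sub>1 \<or> qf_sat \<Pi> i \<psi>\<^sub>2"
| "qf_sat \<Pi> i (Next \<psi>) \<longleftrightarrow> qf_sat \<Pi> (i + 1) \<psi>"
| "qf_sat \<Pi> i (Until \<psi>\<^sub>1 \<psi>\<^sub>2) \<longleftrightarrow>
     (\<exists>j\<ge>i. qf_sat \<Pi> j \<psi>\<^sub>2 \<and> (\<forall>k. i \<le> k \<and> k < j \<longrightarrow> qf_sat \<Pi> k \<psi>\<^sub>1))"

primrec sat :: "'a word set \<Rightarrow> ('a, 'v) assignment \<Rightarrow> nat \<Rightarrow> ('a, 'v) hyperltl \<Rightarrow> bool" where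
  "sat Tr \<Pi> i (Forall \<pi> \<phi>) \<longleftrightarrow> (\<forall>t\<in>Tr. sat Tr (\<Pi>(\<pi> \<mapsto> t)) i \<phi>)"
| "sat Tr \<Pi> i (Exists \<pi> \<phi>) \<longleftrightarrow> (\<exists>t\<in>Tr. sat Tr (\<Pi>(\<pi> \<mapsto> t)) i \<phi>)"
| "sat Tr \<Pi> i (QF \<psi>) \<longleftrightarrow> qf_sat \<Pi> i \<psi>"

definition models :: "'a set \<Rightarrow> ('s, 'a) transys \<Rightarrow> ('a, 'v) hyperltl \<Rightarrow> bool" where
  "models Inp \<S> \<phi> \<longleftrightarrow> sat (traces Inp \<S>) Map.empty 0 \<phi>"

text \<open>
  The power \<open>A\<^sup>n\<close> is the set of lists of length \<open>n\<close> over \<open>A\<close>, so that the components of a tuple are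
  numbered from 0 and \<open>A\<^sup>0\<close> contains only the empty list.
\<close>

definition tuples :: "'b set \<Rightarrow> nat \<Rightarrow> 'b list set" where
  "tuples A n = {xs \<in> lists A. length xs = n}"

definition strategy :: "'a set \<Rightarrow> nat \<Rightarrow> nat \<Rightarrow> ('a set list list \<Rightarrow> 'a set list) \<Rightarrow> bool" where
  "strategy Inp n m \<sigma> \<longleftrightarrow>
     (\<forall>h \<in> lists (tuples (Pow Inp) n). \<sigma> h \<in> tuples (Pow Inp) m)"

definition response :: "('b list \<Rightarrow> 'c) \<Rightarrow> (nat \<Rightarrow> 'b) \<Rightarrow> nat \<Rightarrow> 'c" where
  "response \<sigma> u = (\<lambda>i. \<sigma> (prefix u i))"

definition component_traces ::
  "('s, 'a) transys \<Rightarrow> nat \<Rightarrow> (nat \<Rightarrow> 'a set list) \<Rightarrow> 'a word list" where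
  "component_traces \<S> n u = map (\<lambda>j. trace_on \<S> (\<lambda>i. u i ! j)) [0..<n]"

end

theory Submission
  imports Defs
begin

text \<open>A winning strategy is a Skolem function in disguise. A block of like quantifiers ranges
  over tuples of traces, and an n-tuple of traces of \<open>\<S>\<close> comes from a single
  infinite word over n-tuples of inputs (\<open>tuple_of_traces_obtains_inputs\<close>); conversely
  every such word yields a tuple of traces (\<open>component_traces_in_tuples\<close>). For the
  forall-exists formula, recover inputs \<open>u\<close> from the given traces and let the strategy
  answer \<open>u\<close>: its response drives the traces that witness the existential block. For
  the exists-forall formula there is only one history of each length, so the response is one fixed
  word, available before the universal traces are chosen.\<close>

lemma tuples_0 [simp]: "tuples A 0 = {[]}"
  by (auto simp: tuples_def)

lemma tuples_Suc: "tuples A (Suc n) = (\<Union>x\<in>A. (#) x ` tuples A n)"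
  by (auto simp: tuples_def length_Suc_conv image_iff)

text \<open>Turns nested quantifiers into one over tuples. \<open>\<Pi>\<close> must stay arbitrary
  in the induction, because peeling off the outermost quantifier updates it before the remaining
  ones are read.\<close>

lemma sat_foldr_Forall:
  "sat Tr \<Pi> i (foldr Forall \<pi> \<phi>) \<longleftrightarrow> (\<forall>ts\<in>tuples Tr (length \<pi>). sat Tr (\<Pi>(\<pi> [\<mapsto>] ts)) i \<phi>)"
  by (induction \<pi> arbitrary: \<Pi>) (simp_all add: tuples_Suc)

lemma sat_foldr_Exists:
  "sat Tr \<Pi> i (foldr Exists \<pi> \<phi>) \<longleftrightarrow> (\<exists>ts\<in>tuples Tr (length \<pi>). sat Tr (\<Pi>(\<pi> [\<mapsto>] ts)) i \<phi>)"
  by (induction \<pi> arbitrary: \<Pi>) (simp_all add: tuples_Suc)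

lemma component_traces_in_tuples:
  assumes "\<And>i. u i \<in> tuples (Pow Inp) n"
  shows "component_traces \<S> n u \<in> tuples (traces Inp \<S>) n"
proof -
  have "u i ! j \<in> Pow Inp" if "j < n" for i j
    using assms[of i] that by (auto simp: tuples_def in_lists_conv_set)
  then show ?thesis
    by (fastforce simp: component_traces_def tuples_def traces_def)
qed

text \<open>Every trace is generated by some input word; choose one for each entry and run these
  words in parallel.\<close>

lemma tuple_of_traces_obtains_inputs:
  assumes "ts \<in> tuples (traces Inp \<S>) n"
  obtains u where "\<And>i. u i \<in> tuples (Pow Inp) n" and "component_traces \<S> n u = ts"
proof -
  have "\<forall>j<n. \<exists>w. ts ! j = trace_on \<S> w \<and> (\<forall>i. w i \<in> Pow Inp)"
    using assms by (auto simp: tuples_def traces_def in_lists_conv_set)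
  then obtain w where w: "\<And>j. j < n \<Longrightarrow> ts ! j = trace_on \<S> (w j) \<and> (\<forall>i. w j i \<in> Pow Inp)"
    by metis
  \<comment> \<open>Transposition: letter \<open>i\<close> of \<open>u\<close> collects the
    \<open>i\<close>-th letters of all n words, so projecting \<open>u\<close> to component
    \<open>j\<close> gives back \<open>w j\<close>.\<close>
  define u where "u i = map (\<lambda>j. w j i) [0..<n]" for i
  show thesis
  proof
    show "u i \<in> tuples (Pow Inp) n" for i
      using w by (fastforce simp: u_def tuples_def)
    show "component_traces \<S> n u = ts"
      using w assms by (intro nth_equalityI) (auto simp: component_traces_def u_def tuples_def)
  qed
qed

text \<open>Each finite prefix of \<open>u\<close>, including the empty one at \<open>i = 0\<close>,
  is a legal history for \<open>\<sigma>\<close>.\<close>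

lemma response_in_tuples:
  assumes "strategy Inp n m \<sigma>" and "\<And>i. u i \<in> tuples (Pow Inp) n"
  shows "response \<sigma> u i \<in> tuples (Pow Inp) m"
  using assms by (auto simp: strategy_def response_def prefix_def in_lists_conv_set)

theorem theorem4:
  fixes Inp Out :: "'a set"
    and \<S> :: "('s, 'a) transys"
    and n m :: nat
    and \<phi> :: "('a, 'v) qf"
  assumes "finite Inp" and "finite Out" and "Inp \<inter> Out = {}"
    and "transition_system Inp Out \<S>"
    and "props \<phi> \<subseteq> Inp \<union> Out"
  shows
    "(\<forall>\<pi> \<pi>' :: 'v list.
        length \<pi> = n \<longrightarrow> length \<pi>' = m \<longrightarrow> distinct (\<pi> @ \<pi>') \<longrightarrow>
        tvars \<phi> \<subseteq> set \<pi> \<union> set \<pi>' \<longrightarrow>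
        (\<exists>\<sigma>. strategy Inp n m \<sigma> \<and>
          (\<forall>u. (\<forall>i. u i \<in> tuples (Pow Inp) n) \<longrightarrow>
            qf_sat (Map.empty(\<pi> [\<mapsto>] component_traces \<S> n u,
                              \<pi>' [\<mapsto>] component_traces \<S> m (response \<sigma> u))) 0 \<phi>)) \<longrightarrow>
        models Inp \<S> (foldr Forall \<pi> (foldr Exists \<pi>' (QF \<phi>)))) \<and>
     (\<forall>\<pi> \<pi>' :: 'v list.
        length \<pi> = m \<longrightarrow> length \<pi>' = n \<longrightarrow> distinct (\<pi> @ \<pi>') \<longrightarrow>
        tvars \<phi> \<subseteq> set \<pi> \<union> set \<pi>' \<longrightarrow>
        (\<exists>\<sigma>. strategy Inp 0 m \<sigma> \<and>
          (\<forall>\<rho>' \<in> tuples (traces Inp \<S>) n.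
            qf_sat (Map.empty(\<pi> [\<mapsto>] component_traces \<S> m (response \<sigma> (\<lambda>_. [])),
                              \<pi>' [\<mapsto>] \<rho>')) 0 \<phi>)) \<longrightarrow>
        models Inp \<S> (foldr Exists \<pi> (foldr Forall \<pi>' (QF \<phi>))))"
proof (intro conjI allI impI; elim exE conjE)
  fix \<pi> \<pi>' :: "'v list" and \<sigma>
  assume len: "length \<pi> = n" "length \<pi>' = m" and \<sigma>: "strategy Inp n m \<sigma>"
    and win: "\<forall>u. (\<forall>i. u i \<in> tuples (Pow Inp) n) \<longrightarrow>
      qf_sat (Map.empty(\<pi> [\<mapsto>] component_traces \<S> n u,
                        \<pi>' [\<mapsto>] component_traces \<S> m (response \<sigma> u))) 0 \<phi>"
  \<comment> \<open>This is the semantics of the formula once both quantifier blocks are collapsed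
    to tuples.\<close>
  have "\<exists>ts'\<in>tuples (traces Inp \<S>) m. qf_sat (Map.empty(\<pi> [\<mapsto>] ts, \<pi>' [\<mapsto>] ts')) 0 \<phi>"
    if ts: "ts \<in> tuples (traces Inp \<S>) n" for ts
  proof -
    from ts obtain u
      where u: "\<And>i. u i \<in> tuples (Pow Inp) n" and ts_eq: "component_traces \<S> n u = ts"
      using tuple_of_traces_obtains_inputs by metis
    show ?thesis
    proof
      \<comment> \<open>The witness: the traces obtained by feeding the strategy's answers to
        \<open>u\<close> into \<open>\<S>\<close>.\<close>
      show "component_traces \<S> m (response \<sigma> u) \<in> tuples (traces Inp \<S>) m"
        by (rule component_traces_in_tuples) (rule response_in_tuples[OF \<sigma> u])
      show "qf_sat (Map.empty(\<pi> [\<mapsto>] ts, \<pi>' [\<mapsto>] component_traces \<S> m (response \<sigma> u))) 0 \<phi>"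
        using win[rule_format, of u, OF u] by (simp only: ts_eq)
    qed
  qed
  then show "models Inp \<S> (foldr Forall \<pi> (foldr Exists \<pi>' (QF \<phi>)))"
    by (simp add: models_def sat_foldr_Forall sat_foldr_Exists len)
next
  fix \<pi> \<pi>' :: "'v list" and \<sigma>
  assume len: "length \<pi> = m" "length \<pi>' = n" and \<sigma>: "strategy Inp 0 m \<sigma>"
    and win: "\<forall>\<rho>'\<in>tuples (traces Inp \<S>) n.
      qf_sat (Map.empty(\<pi> [\<mapsto>] component_traces \<S> m (response \<sigma> (\<lambda>_. [])),
                        \<pi>' [\<mapsto>] \<rho>')) 0 \<phi>"
  \<comment> \<open>The constant word \<open>\<lambda>_. []\<close> is the only word over 0-tuples.
    This tuple of traces does not mention \<open>\<rho>'\<close>, so one witness serves all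
    universal choices.\<close>
  have "component_traces \<S> m (response \<sigma> (\<lambda>_. [])) \<in> tuples (traces Inp \<S>) m"
    by (intro component_traces_in_tuples response_in_tuples[OF \<sigma>]) simp
  with win show "models Inp \<S> (foldr Exists \<pi> (foldr Forall \<pi>' (QF \<phi>)))"
    by (auto simp: models_def sat_foldr_Forall sat_foldr_Exists len)
qed

end
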